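(* Let $K$ be a field, let $d_1, d_2, \ldots, d_{r+1}$ be nonnegative integers with $0 \in \{d_1, d_2, \ldots, d_{r+1}\}$, and let $F : K^n \to K^m$ be a polynomial map such that the degree of each term of $F$ is contained in $\{d_1, d_2, \ldots, d_r, d_{r+1}\}$. Assume furthermore that for all $c = (c_1,\ldots,c_r) \in K^r$, the polynomial $$\frac{\partial}{\partial t}\left(t^{d_{r+1}} + c_r t^{d_r} + \cdots + c_2 t^{d_2} + c_1 t^{d_1}\right) \in K[t]$$ has a root in $K$. Let $b \in K^n$ be nonzero and assume that $F(a_1 b) = F(a_2 b) = \cdots = F(a_r b)$ for certain $a_1,\ldots,a_r \in K$ such that the $r\times r$ matrix $$A^{(r,r)} = \begin{pmatrix} a_1^{d_1} & a_2^{d_1} & \cdots & a_r^{d_1} \\ a_1^{d_2} & a_2^{d_2} & \cdots & a_r^{d_2} \\ \vdots & \vdots & \ddots & \vdots \\ a_1^{d_r} & a_2^{d_r} & \cdots & a_r^{d_r} \end{pmatrix}$$ has rank $r$. Then there is an $a_{r+1} \in K$ such that $(\mathcal{J} F)|_{x = a_{r+1} b} \cdot b = 0$. In particular, $\operatorname{rk}\,(\mathcal{J} F)|_{x = a_{r+1} b} < n$.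
   Context: A polynomial map $F : K^n \to K^m$ is a tuple $F = (F_1,\ldots,F_m)$ of polynomials $F_i \in K[x_1,\ldots,x_n]$ (identified with the tuple of polynomials, not merely the induced function). Its Jacobian matrix is the $m\times n$ matrix $\mathcal{J} F = \left(\frac{\partial F_i}{\partial x_j}\right)_{i,j}$ (formal partial derivatives), and $(\mathcal{J}F)|_{x=p}$ denotes its evaluation at $x = p \in K^n$. A term of $F$ is a monomial occurring with nonzero coefficient in some component $F_i$; its degree is its total degree. Here $r \ge 1$, and $0^0 = 1$ by convention. The zero polynomial has every element of $K$ as a root. *)

theory Defs
  imports
    "HOL-Library.Poly_Mapping"
    "HOL-Computational_Algebra.Polynomial"
    "Jordan_Normal_Form.DL_Rank"
begin

text \<open>
  Formal multivariate polynomials: finitely supported maps from exponent vectors (monomials)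
  to coefficients. The variables are \<open>x\<^sub>0, x\<^sub>1, \<dots>\<close>; a polynomial in \<open>n\<close> variables is one that
  mentions only \<open>x\<^sub>0, \<dots>, x\<^sub>n\<^sub>-\<^sub>1\<close>. The exponent vectors in \<open>keys p\<close> are the terms of \<open>p\<close>.
\<close>

type_synonym monomial = "nat \<Rightarrow>\<^sub>0 nat"
type_synonym 'a mpoly = "monomial \<Rightarrow>\<^sub>0 'a"

definition mon_degree :: "monomial \<Rightarrow> nat" where
  "mon_degree e = (\<Sum>j\<in>Poly_Mapping.keys e. Poly_Mapping.lookup e j)"

definition mpoly_vars :: "'a::zero mpoly \<Rightarrow> nat set" where
  "mpoly_vars p = (\<Union>e\<in>Poly_Mapping.keys p. Poly_Mapping.keys e)"

definition mpoly_eval :: "'a::comm_semiring_1 vec \<Rightarrow> 'a mpoly \<Rightarrow> 'a" where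
  "mpoly_eval x p =
     (\<Sum>e\<in>Poly_Mapping.keys p.
        Poly_Mapping.lookup p e *
        (\<Prod>j\<in>Poly_Mapping.keys e. (x $ j) ^ Poly_Mapping.lookup e j))"

text \<open>
  The truncated subtraction below is harmless: if \<open>x\<^sub>j\<close> does not occur in the monomial \<open>e\<close>,
  the coefficient is \<open>0\<close>.
\<close>

definition mpoly_pderiv :: "nat \<Rightarrow> 'a::comm_semiring_1 mpoly \<Rightarrow> 'a mpoly" where
  "mpoly_pderiv j p =
     (\<Sum>e\<in>Poly_Mapping.keys p.
        Poly_Mapping.single (e - Poly_Mapping.single j 1)
          (of_nat (Poly_Mapping.lookup e j) * Poly_Mapping.lookup p e))"

definition poly_map :: "nat \<Rightarrow> nat \<Rightarrow> 'a::zero mpoly vec \<Rightarrow> bool" where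
  "poly_map n m F \<longleftrightarrow> F \<in> carrier_vec m \<and> (\<forall>i<m. mpoly_vars (F $ i) \<subseteq> {..<n})"

definition poly_map_eval :: "'a::comm_semiring_1 mpoly vec \<Rightarrow> 'a vec \<Rightarrow> 'a vec" where
  "poly_map_eval F x = map_vec (mpoly_eval x) F"

definition poly_map_terms :: "'a::zero mpoly vec \<Rightarrow> monomial set" where
  "poly_map_terms F = (\<Union>i<dim_vec F. Poly_Mapping.keys (F $ i))"

text \<open>The number \<open>n\<close> of variables is explicit, as it is not determined by the polynomials.\<close>

definition jacobian :: "nat \<Rightarrow> 'a::comm_semiring_1 mpoly vec \<Rightarrow> 'a mpoly mat" where
  "jacobian n F = mat (dim_vec F) n (\<lambda>(i, j). mpoly_pderiv j (F $ i))"

definition jacobian_at :: "nat \<Rightarrow> 'a::comm_semiring_1 mpoly vec \<Rightarrow> 'a vec \<Rightarrow> 'a mat" where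
  "jacobian_at n F p = map_mat (mpoly_eval p) (jacobian n F)"

end

theory Submission
  imports Defs
begin

text \<open>
  Restricted to the line through \<open>b\<close>, each component of \<open>F\<close> is a polynomial \<open>g\<close> in one
  variable \<open>t\<close> whose exponents are among the \<open>d(k)\<close>. As the matrix is invertible, there are
  unique \<open>c\<^sub>i\<close> for which \<open>P = t^d(r + 1) + (\<Sum>i\<in>{1..r}. c\<^sub>i t^d(i))\<close> vanishes at all \<open>a\<^sub>j\<close>.
  If \<open>v\<close> is the common value of \<open>g\<close> at the \<open>a\<^sub>j\<close>, then, as some \<open>d(k)\<close> is \<open>0\<close>, the exponents
  of \<open>g - v\<close> are also among the \<open>d(k)\<close>. Subtracting the right multiple of \<open>P\<close> leaves a
  combination of the \<open>t^d(i)\<close> with \<open>i \<le> r\<close> that vanishes at all \<open>a\<^sub>j\<close>, hence is zero. Thus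
  every component has the form \<open>v + w P\<close>, and a single root of \<open>P'\<close> kills the derivatives
  along \<open>b\<close> of all components.
\<close>

section \<open>Polynomials on a line through the origin\<close>

definition mon_eval :: "'a::comm_semiring_1 vec \<Rightarrow> monomial \<Rightarrow> 'a" where
  "mon_eval x e = (\<Prod>j\<in>Poly_Mapping.keys e. (x $ j) ^ Poly_Mapping.lookup e j)"

text \<open>The restriction t -> p(t b), kept as a formal polynomial rather than a function, so that
  its coefficients and its derivative make sense over finite fields too.\<close>

definition mpoly_on_line :: "'a::comm_semiring_1 vec \<Rightarrow> 'a mpoly \<Rightarrow> 'a poly" where
  "mpoly_on_line b p =
     (\<Sum>e\<in>Poly_Mapping.keys p. monom (Poly_Mapping.lookup p e * mon_eval b e) (mon_degree e))"

lemma mpoly_eval_conv_mon_eval: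
  "mpoly_eval x p = (\<Sum>e\<in>Poly_Mapping.keys p. Poly_Mapping.lookup p e * mon_eval x e)"
  by (simp add: mpoly_eval_def mon_eval_def)

lemma mon_eval_superset:
  assumes "finite S" "Poly_Mapping.keys e \<subseteq> S"
  shows "mon_eval x e = (\<Prod>j\<in>S. (x $ j) ^ Poly_Mapping.lookup e j)"
  unfolding mon_eval_def
  by (rule prod.mono_neutral_left) (use assms in \<open>auto simp: in_keys_iff\<close>)

lemma mon_degree_superset:
  assumes "finite S" "Poly_Mapping.keys e \<subseteq> S"
  shows "mon_degree e = (\<Sum>j\<in>S. Poly_Mapping.lookup e j)"
  unfolding mon_degree_def
  by (rule sum.mono_neutral_left) (use assms in \<open>auto simp: in_keys_iff\<close>)

lemma mon_eval_add: "mon_eval x (e + f) = mon_eval x e * mon_eval x f"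
proof -
  let ?S = "Poly_Mapping.keys e \<union> Poly_Mapping.keys f"
  have "Poly_Mapping.keys (e + f) \<subseteq> ?S"
    by (rule keys_add)
  then show ?thesis
    by (simp add: mon_eval_superset[of ?S] lookup_add power_add prod.distrib)
qed

lemma mon_degree_add: "mon_degree (e + f) = mon_degree e + mon_degree f"
proof -
  let ?S = "Poly_Mapping.keys e \<union> Poly_Mapping.keys f"
  have "Poly_Mapping.keys (e + f) \<subseteq> ?S"
    by (rule keys_add)
  then show ?thesis
    by (simp add: mon_degree_superset[of ?S] lookup_add sum.distrib)
qed

lemma mon_eval_single [simp]: "mon_eval x (Poly_Mapping.single j 1) = x $ j"
  by (simp add: mon_eval_def)

lemma mon_degree_single [simp]: "mon_degree (Poly_Mapping.single j k) = k"
  by (simp add: mon_degree_def)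

text \<open>Scaling acts only on positions below \<open>dim_vec b\<close>; entries beyond are
  unspecified, hence the bound on the keys.\<close>

lemma mon_eval_smult:
  assumes "Poly_Mapping.keys e \<subseteq> {..<dim_vec b}"
  shows "mon_eval (t \<cdot>\<^sub>v b) e = t ^ mon_degree e * mon_eval b e"
proof -
  have "mon_eval (t \<cdot>\<^sub>v b) e
      = (\<Prod>j\<in>Poly_Mapping.keys e. t ^ Poly_Mapping.lookup e j * (b $ j) ^ Poly_Mapping.lookup e j)"
    unfolding mon_eval_def
    by (rule prod.cong) (use assms in \<open>auto simp: power_mult_distrib\<close>)
  then show ?thesis
    by (simp add: prod.distrib mon_eval_def mon_degree_def power_sum)
qed

lemma mpoly_eval_add: "mpoly_eval x (p + q) = mpoly_eval x p + mpoly_eval x q"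
  unfolding mpoly_eval_conv_mon_eval
  by (rule setsum_keys_plus_distrib) (simp_all add: distrib_right)

lemma mpoly_eval_sum: "mpoly_eval x (\<Sum>i\<in>I. f i) = (\<Sum>i\<in>I. mpoly_eval x (f i))"
  by (induction I rule: infinite_finite_induct) (simp_all add: mpoly_eval_add, simp_all add: mpoly_eval_def)

lemma mpoly_eval_single: "mpoly_eval x (Poly_Mapping.single e c) = c * mon_eval x e"
  by (simp add: mpoly_eval_conv_mon_eval)

lemma mpoly_eval_pderiv:
  "mpoly_eval x (mpoly_pderiv j p) =
     (\<Sum>e\<in>Poly_Mapping.keys p. of_nat (Poly_Mapping.lookup e j) * Poly_Mapping.lookup p e *
        mon_eval x (e - Poly_Mapping.single j 1))"
  by (simp add: mpoly_pderiv_def mpoly_eval_sum mpoly_eval_single)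

lemma poly_mpoly_on_line:
  assumes "mpoly_vars p \<subseteq> {..<dim_vec b}"
  shows "poly (mpoly_on_line b p) t = mpoly_eval (t \<cdot>\<^sub>v b) p"
  unfolding mpoly_on_line_def mpoly_eval_conv_mon_eval poly_sum
proof (rule sum.cong)
  fix e assume "e \<in> Poly_Mapping.keys p"
  with assms have "Poly_Mapping.keys e \<subseteq> {..<dim_vec b}"
    by (auto simp: mpoly_vars_def)
  then show "poly (monom (Poly_Mapping.lookup p e * mon_eval b e) (mon_degree e)) t
      = Poly_Mapping.lookup p e * mon_eval (t \<cdot>\<^sub>v b) e"
    by (simp add: poly_monom mon_eval_smult mult_ac)
qed simp

text \<open>Only this inclusion is available: terms of equal degree can cancel on the line, and a
  monomial can vanish at \<open>b\<close>.\<close>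

lemma coeff_mpoly_on_line_nonzero:
  assumes "coeff (mpoly_on_line b p) k \<noteq> 0"
  shows "k \<in> mon_degree ` Poly_Mapping.keys p"
proof -
  have "(\<Sum>e\<in>Poly_Mapping.keys p.
      coeff (monom (Poly_Mapping.lookup p e * mon_eval b e) (mon_degree e)) k) \<noteq> 0"
    using assms by (simp add: mpoly_on_line_def coeff_sum)
  then obtain e where "e \<in> Poly_Mapping.keys p"
      "coeff (monom (Poly_Mapping.lookup p e * mon_eval b e) (mon_degree e)) k \<noteq> 0"
    by (rule sum.not_neutral_contains_not_neutral)
  then show ?thesis
    by (auto simp: coeff_monom split: if_splits)
qed

text \<open>The factor \<open>b $ j\<close> removed by differentiation is put back, but the factor t
  is not; hence the exponent one below the degree. If x_j is absent from \<open>e\<close>, the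
  leading factor makes both sides 0.\<close>

lemma mon_eval_pderiv_times:
  assumes "Poly_Mapping.keys e \<subseteq> {..<dim_vec b}"
  shows "of_nat (Poly_Mapping.lookup e j) * mon_eval (t \<cdot>\<^sub>v b) (e - Poly_Mapping.single j 1) * b $ j
       = of_nat (Poly_Mapping.lookup e j) * (t ^ (mon_degree e - 1) * mon_eval b e)"
proof (cases "Poly_Mapping.lookup e j = 0")
  case False
  define e' where "e' = e - Poly_Mapping.single j 1"
  have e: "e = e' + Poly_Mapping.single j 1"
    by (rule poly_mapping_eqI)
      (use False in \<open>auto simp: e'_def lookup_add lookup_minus lookup_single when_def\<close>)
  have "Poly_Mapping.keys e' \<subseteq> Poly_Mapping.keys e"
    by (auto simp: e'_def in_keys_iff lookup_minus)
  then have "mon_eval (t \<cdot>\<^sub>v b) e' = t ^ mon_degree e' * mon_eval b e'"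
    using assms by (intro mon_eval_smult) auto
  moreover have "mon_degree e = mon_degree e' + 1" "mon_eval b e = mon_eval b e' * b $ j"
    by (simp_all only: e mon_degree_add mon_eval_add mon_degree_single mon_eval_single)
  ultimately show ?thesis
    unfolding e'_def [symmetric] by (simp add: mult_ac)
qed simp

text \<open>Formal chain rule along t -> t b. For each monomial it is Euler's identity: the
  exponents add up to the degree, which is the factor that differentiating a power of t
  produces.\<close>

lemma poly_pderiv_mpoly_on_line:
  fixes b :: "'a::idom vec"
  assumes "mpoly_vars p \<subseteq> {..<dim_vec b}"
  shows "(\<Sum>j<dim_vec b. mpoly_eval (t \<cdot>\<^sub>v b) (mpoly_pderiv j p) * b $ j)
       = poly (pderiv (mpoly_on_line b p)) t"
proof -
  have "(\<Sum>j<dim_vec b. mpoly_eval (t \<cdot>\<^sub>v b) (mpoly_pderiv j p) * b $ j)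
      = (\<Sum>j<dim_vec b. \<Sum>e\<in>Poly_Mapping.keys p. Poly_Mapping.lookup p e *
          (of_nat (Poly_Mapping.lookup e j) *
            mon_eval (t \<cdot>\<^sub>v b) (e - Poly_Mapping.single j 1) * b $ j))"
    by (simp add: mpoly_eval_pderiv sum_distrib_left mult_ac)
  also have "\<dots> = (\<Sum>e\<in>Poly_Mapping.keys p. Poly_Mapping.lookup p e *
      (\<Sum>j<dim_vec b. of_nat (Poly_Mapping.lookup e j) *
            mon_eval (t \<cdot>\<^sub>v b) (e - Poly_Mapping.single j 1) * b $ j))"
    by (subst sum.swap) (simp add: sum_distrib_left)
  also have "\<dots> = (\<Sum>e\<in>Poly_Mapping.keys p.
      poly (pderiv (monom (Poly_Mapping.lookup p e * mon_eval b e) (mon_degree e))) t)"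
  proof (rule sum.cong)
    fix e assume "e \<in> Poly_Mapping.keys p"
    with assms have e: "Poly_Mapping.keys e \<subseteq> {..<dim_vec b}"
      by (auto simp: mpoly_vars_def)
    have "(\<Sum>j<dim_vec b. of_nat (Poly_Mapping.lookup e j) *
            mon_eval (t \<cdot>\<^sub>v b) (e - Poly_Mapping.single j 1) * b $ j)
        = of_nat (mon_degree e) * (t ^ (mon_degree e - 1) * mon_eval b e)"
      unfolding mon_eval_pderiv_times[OF e]
      by (simp add: mon_degree_superset[OF _ e] sum_distrib_right)
    then show "Poly_Mapping.lookup p e * (\<Sum>j<dim_vec b. of_nat (Poly_Mapping.lookup e j) *
            mon_eval (t \<cdot>\<^sub>v b) (e - Poly_Mapping.single j 1) * b $ j)
        = poly (pderiv (monom (Poly_Mapping.lookup p e * mon_eval b e) (mon_degree e))) t"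
      by (simp add: pderiv_monom poly_monom mult_ac)
  qed simp
  also have "\<dots> = poly (pderiv (mpoly_on_line b p)) t"
    by (simp add: mpoly_on_line_def poly_sum higher_pderiv_sum[of 1, simplified])
  finally show ?thesis .
qed

section \<open>Interpolation with prescribed exponents\<close>

lemma poly_eq_sum_monom:
  fixes h :: "'a::comm_ring_1 poly"
  assumes "finite I" "\<And>k. coeff h k \<noteq> 0 \<Longrightarrow> k \<in> d ` I"
  shows "\<exists>w. h = (\<Sum>i\<in>I. monom (w i) (d i))"
  using assms
proof (induction I arbitrary: h rule: finite_induct)
  case empty
  then have "h = 0"
    by (intro poly_eqI) auto
  then show ?case
    by simp
next
  case (insert i I)
  \<comment> \<open>The whole coefficient at \<open>d i\<close> is assigned to \<open>i\<close>. As
    \<open>h'\<close> has coefficient 0 there, an index in \<open>I\<close> with the same exponent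
    does no harm, so \<open>d\<close> may repeat values.\<close>
  define h' where "h' = h - monom (coeff h (d i)) (d i)"
  have "k \<in> d ` I" if "coeff h' k \<noteq> 0" for k
    using that insert.prems[of k] by (cases "k = d i") (auto simp: h'_def coeff_monom)
  then obtain w where w: "h' = (\<Sum>i\<in>I. monom (w i) (d i))"
    using insert.IH by blast
  have "h = (\<Sum>l\<in>insert i I. monom ((w(i := coeff h (d i))) l) (d l))"
  proof -
    have "(\<Sum>l\<in>I. monom ((w(i := coeff h (d i))) l) (d l)) = h'"
      unfolding w by (rule sum.cong) (use insert.hyps in auto)
    then show ?thesis
      using insert.hyps by (simp add: h'_def)
  qed
  then show ?case
    by blast
qed

lemma det_nonzero_solvable:
  fixes A :: "'a::field mat"
  assumes A: "A \<in> carrier_mat n n" and "det A \<noteq> 0" and y: "y \<in> carrier_vec n"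
  shows "\<exists>x\<in>carrier_vec n. A *\<^sub>v x = y"
proof -
  obtain B where B: "B \<in> carrier_mat n n" "A * B = 1\<^sub>m n"
    using det_non_zero_imp_unit[OF A \<open>det A \<noteq> 0\<close>, of "()"]
    by (auto simp: Units_def ring_mat_def)
  have "A *\<^sub>v (B *\<^sub>v y) = y"
    using assoc_mult_mat_vec[OF A B(1) y] B(2) y by simp
  moreover have "B *\<^sub>v y \<in> carrier_vec n"
    using B(1) y by simp
  ultimately show ?thesis
    by blast
qed

locale exponent_interpolation =
  fixes r :: nat and d :: "nat \<Rightarrow> nat" and a :: "nat \<Rightarrow> 'a::field"
  assumes det_nonzero: "det (mat r r (\<lambda>(i, j). a (j + 1) ^ d (i + 1))) \<noteq> 0"
begin

text \<open>A generalized Vandermonde matrix. Transposing gives one row per node, so that it maps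
  coefficient vectors to vectors of values. Vectors count from 0, while \<open>a\<close> and
  \<open>d\<close> count from 1.\<close>

definition power_mat where "power_mat = transpose_mat (mat r r (\<lambda>(i, j). a (j + 1) ^ d (i + 1)))"

lemma power_mat_carrier: "power_mat \<in> carrier_mat r r"
  by (simp add: power_mat_def)

lemma det_power_mat: "det power_mat \<noteq> 0"
  using det_nonzero by (simp add: power_mat_def det_transpose[of _ r])

lemma power_mat_mult_vec:
  assumes "j < r"
  shows "(power_mat *\<^sub>v vec r (\<lambda>i. w (i + 1))) $ j = poly (\<Sum>i = 1..r. monom (w i) (d i)) (a (j + 1))"
proof -
  have "(power_mat *\<^sub>v vec r (\<lambda>i. w (i + 1))) $ j = (\<Sum>i<r. a (j + 1) ^ d (i + 1) * w (i + 1))"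
    using assms by (simp add: power_mat_def scalar_prod_def lessThan_atLeast0)
  also have "\<dots> = (\<Sum>i = 1..r. w i * a (j + 1) ^ d i)"
    by (rule sum.reindex_bij_witness[of _ "\<lambda>i. i - 1" Suc]) (auto simp: mult_ac)
  finally show ?thesis
    by (simp add: poly_sum poly_monom)
qed

text \<open>The coefficients form a vector in the kernel of an invertible matrix.\<close>

lemma interpolation_unique:
  assumes "\<And>j. j \<in> {1..r} \<Longrightarrow> poly (\<Sum>i = 1..r. monom (w i) (d i)) (a j) = 0"
  shows "(\<Sum>i = 1..r. monom (w i) (d i)) = 0"
proof -
  let ?x = "vec r (\<lambda>i. w (i + 1))"
  have "power_mat *\<^sub>v ?x = 0\<^sub>v r"
  proof (rule eq_vecI)
    fix j assume "j < dim_vec (0\<^sub>v r :: 'a vec)"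
    then have j: "j < r"
      by simp
    show "(power_mat *\<^sub>v ?x) $ j = 0\<^sub>v r $ j"
      unfolding power_mat_mult_vec[OF j] using assms[of "j + 1"] j by simp
  qed (use power_mat_carrier in auto)
  then have x: "?x = 0\<^sub>v r"
    using det_0_iff_vec_prod_zero_field[OF power_mat_carrier] det_power_mat vec_carrier by blast
  have "w i = 0" if "i \<in> {1..r}" for i
    using arg_cong[OF x, of "\<lambda>v. v $ (i - 1)"] that by auto
  then show ?thesis
    by simp
qed

lemma interpolation_exists:
  "\<exists>w. \<forall>j\<in>{1..r}. poly (\<Sum>i = 1..r. monom (w i) (d i)) (a j) = y j"
proof -
  obtain x where x: "x \<in> carrier_vec r" "power_mat *\<^sub>v x = vec r (\<lambda>j. y (j + 1))"
    using det_nonzero_solvable[OF power_mat_carrier det_power_mat, of "vec r (\<lambda>j. y (j + 1))"] by auto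
  \<comment> \<open>The form \<open>i + 1 - 1\<close> is what \<open>power_mat_mult_vec\<close>
    yields for the coefficients \<open>x $ (i - 1)\<close>.\<close>
  have "vec r (\<lambda>i. x $ (i + 1 - 1)) = x"
    by (rule eq_vecI) (use x in auto)
  then have *: "poly (\<Sum>i = 1..r. monom (x $ (i - 1)) (d i)) (a (j + 1)) = y (j + 1)" if "j < r" for j
    using power_mat_mult_vec[OF that, of "\<lambda>i. x $ (i - 1)"] x that by simp
  have "poly (\<Sum>i = 1..r. monom (x $ (i - 1)) (d i)) (a j) = y j" if "j \<in> {1..r}" for j
  proof -
    from that obtain l where "j = l + 1" "l < r"
      by (cases j) auto
    then show ?thesis
      using * by simp
  qed
  then show ?thesis
    by (intro exI [of _ "\<lambda>i. x $ (i - 1)"] ballI)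
qed

lemma vanishing_eq_smult:
  assumes supp: "\<And>k. coeff h k \<noteq> 0 \<Longrightarrow> k \<in> d ` {1..r + 1}"
    and h: "\<And>j. j \<in> {1..r} \<Longrightarrow> poly h (a j) = 0"
    and P: "P = monom 1 (d (r + 1)) + (\<Sum>i = 1..r. monom (c i) (d i))"
    and P0: "\<And>j. j \<in> {1..r} \<Longrightarrow> poly P (a j) = 0"
  shows "\<exists>w. h = Polynomial.smult w P"
proof -
  obtain w where w: "h = (\<Sum>i = 1..r + 1. monom (w i) (d i))"
    using poly_eq_sum_monom[of "{1..r + 1}" h d] supp by auto
  \<comment> \<open>If \<open>d (r + 1)\<close> equals an earlier exponent, \<open>w (r + 1)\<close>
    need not be a coefficient of \<open>h\<close>. It suffices that the summands with index r + 1
    cancel.\<close>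
  define u where "u i = w i - w (r + 1) * c i" for i
  have eq: "h - Polynomial.smult (w (r + 1)) P = (\<Sum>i = 1..r. monom (u i) (d i))"
  proof -
    have "Polynomial.smult (w (r + 1)) (\<Sum>i = 1..r. monom (c i) (d i))
        = (\<Sum>i = 1..r. monom (w (r + 1) * c i) (d i))"
      using sum_distrib_left[of "[:w (r + 1):]" "\<lambda>i. monom (c i) (d i)" "{1..r}"]
      by (simp add: Polynomial.smult_monom)
    moreover have "h = (\<Sum>i = 1..r. monom (w i) (d i)) + monom (w (r + 1)) (d (r + 1))"
      by (simp add: w)
    moreover have "(\<Sum>i = 1..r. monom (u i) (d i))
        = (\<Sum>i = 1..r. monom (w i) (d i)) - (\<Sum>i = 1..r. monom (w (r + 1) * c i) (d i))"
      unfolding u_def diff_monom [symmetric] by (rule sum_subtractf)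
    ultimately show ?thesis
      by (simp add: P Polynomial.smult_add_right Polynomial.smult_monom)
  qed
  \<comment> \<open>\<open>eq\<close> is used both ways: the sum form matches
    \<open>interpolation_unique\<close>, and the difference form shows the vanishing at the
    nodes.\<close>
  have "h - Polynomial.smult (w (r + 1)) P = 0"
    unfolding eq by (rule interpolation_unique, unfold eq [symmetric]) (simp add: h P0)
  then show ?thesis
    by auto
qed

end

section \<open>The Jacobian along the line\<close>

text \<open>Linear dependence concerns the set of columns, so \<open>v\<close> yields it only if the
  columns are distinct. A repeated column leaves fewer than \<open>nc\<close> vectors in that set,
  which bounds the rank directly.\<close>

lemma (in vec_space) rank_less_if_kernel_nonzero:
  assumes A: "A \<in> carrier_mat n nc"
    and v: "v \<in> carrier_vec nc" "v \<noteq> 0\<^sub>v nc" "A *\<^sub>v v = 0\<^sub>v n"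
  shows "rank A < nc"
proof (cases "distinct (cols A)")
  case True
  then show ?thesis
    using lin_depI[OF A v True] full_rank_lin_indpt[OF A _ True] rank_le_nc[OF A] by linarith
next
  case False
  obtain S where S: "maximal S (\<lambda>T. T \<subseteq> set (cols A) \<and> lin_indpt T)"
    using maximal_exists_superset[of "set (cols A)" "\<lambda>T. T \<subseteq> set (cols A) \<and> lin_indpt T" "{}"]
      finite_lin_indpt2[of "{}"] by auto
  then have "card S \<le> card (set (cols A))"
    by (intro card_mono) (auto simp: maximal_def)
  also have "\<dots> < length (cols A)"
    using False card_distinct card_length nat_less_le by blast
  finally show ?thesis
    using rank_card_indpt[OF A S] A by simp
qed

lemma jacobian_at_mult_vec:
  fixes b :: "'a::idom vec"
  assumes F: "poly_map n m F" and b: "b \<in> carrier_vec n"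
  shows "jacobian_at n F (t \<cdot>\<^sub>v b) *\<^sub>v b = vec m (\<lambda>i. poly (pderiv (mpoly_on_line b (F $ i))) t)"
proof (rule eq_vecI)
  fix i assume "i < dim_vec (vec m (\<lambda>i. poly (pderiv (mpoly_on_line b (F $ i))) t))"
  then have i: "i < m"
    by simp
  have "mpoly_vars (F $ i) \<subseteq> {..<dim_vec b}" "dim_vec F = m"
    using F b i by (auto simp: poly_map_def)
  then show "(jacobian_at n F (t \<cdot>\<^sub>v b) *\<^sub>v b) $ i
      = vec m (\<lambda>i. poly (pderiv (mpoly_on_line b (F $ i))) t) $ i"
    using i b
    by (simp add: jacobian_at_def jacobian_def scalar_prod_def
        lessThan_atLeast0 flip: poly_pderiv_mpoly_on_line)
qed (use F in \<open>auto simp: jacobian_at_def jacobian_def poly_map_def\<close>)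

theorem theorem2p2:
  fixes d :: "nat \<Rightarrow> nat" and r n m :: nat
    and F :: "'a::field mpoly vec"
    and b :: "'a vec" and a :: "nat \<Rightarrow> 'a"
  assumes "r \<ge> 1"
    and "0 \<in> d ` {1..r + 1}"
    and "poly_map n m F"
    and "\<forall>e\<in>poly_map_terms F. mon_degree e \<in> d ` {1..r + 1}"
    and "\<forall>c :: nat \<Rightarrow> 'a. \<exists>t :: 'a.
           poly (pderiv (monom 1 (d (r + 1)) + (\<Sum>i = 1..r. monom (c i) (d i)))) t = 0"
    and "b \<in> carrier_vec n"
    and "b \<noteq> 0\<^sub>v n"
    and "\<forall>i\<in>{1..r}. \<forall>j\<in>{1..r}. poly_map_eval F (a i \<cdot>\<^sub>v b) = poly_map_eval F (a j \<cdot>\<^sub>v b)"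
    and "vec_space.rank r (mat r r (\<lambda>(i, j). a (j + 1) ^ d (i + 1))) = r"
  shows "\<exists>a' :: 'a.
           jacobian_at n F (a' \<cdot>\<^sub>v b) *\<^sub>v b = 0\<^sub>v m \<and>
           vec_space.rank m (jacobian_at n F (a' \<cdot>\<^sub>v b)) < n"
proof -
  interpret exponent_interpolation r d a
  proof
    show "det (mat r r (\<lambda>(i, j). a (j + 1) ^ d (i + 1))) \<noteq> 0"
      unfolding vec_space.det_rank_iff[OF mat_carrier] by (rule assms(9))
  qed
  \<comment> \<open>These values cancel the leading power at every node, so that \<open>P\<close>
    below vanishes there.\<close>
  obtain c where c: "\<forall>j\<in>{1..r}. poly (\<Sum>i = 1..r. monom (c i) (d i)) (a j) = - (a j ^ d (r + 1))"
    using interpolation_exists[of "\<lambda>j. - (a j ^ d (r + 1))"] by blast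
  define P where "P = monom 1 (d (r + 1)) + (\<Sum>i = 1..r. monom (c i) (d i))"
  have P0: "poly P (a j) = 0" if "j \<in> {1..r}" for j
    using c that by (simp add: P_def poly_monom)
  obtain t where t: "poly (pderiv P) t = 0"
    using assms(5) unfolding P_def by blast
  have "poly (pderiv (mpoly_on_line b (F $ i))) t = 0" if i: "i < m" for i
  proof -
    define g where "g = mpoly_on_line b (F $ i)"
    \<comment> \<open>The node \<open>a 1\<close> exists because r is at least 1.\<close>
    define v where "v = poly g (a 1)"
    have dim: "dim_vec F = m" "mpoly_vars (F $ i) \<subseteq> {..<dim_vec b}"
      using assms(3,6) i by (auto simp: poly_map_def)
    have supp: "k \<in> d ` {1..r + 1}" if "coeff (g - [:v:]) k \<noteq> 0" for k
    proof (cases "coeff g k = 0")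
      case True
      \<comment> \<open>Subtracting \<open>v\<close> affects only the coefficient of t^0, and 0 is
        an admissible exponent by assumption.\<close>
      with that have "k = 0"
        by (cases k) auto
      with assms(2) show ?thesis
        by simp
    next
      case False
      then have "k \<in> mon_degree ` Poly_Mapping.keys (F $ i)"
        unfolding g_def by (rule coeff_mpoly_on_line_nonzero)
      with assms(4) i dim show ?thesis
        by (auto simp: poly_map_terms_def)
    qed
    have "poly (g - [:v:]) (a j) = 0" if "j \<in> {1..r}" for j
    proof -
      have "poly_map_eval F (a j \<cdot>\<^sub>v b) = poly_map_eval F (a 1 \<cdot>\<^sub>v b)"
        by (rule assms(8)[rule_format]) (use assms(1) that in auto)
      from arg_cong[OF this, of "\<lambda>v. v $ i"] show ?thesis
        using i dim by (simp add: v_def g_def poly_mpoly_on_line poly_map_eval_def)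
    qed
    then obtain w where "g - [:v:] = Polynomial.smult w P"
      using vanishing_eq_smult[OF supp _ P_def P0] by blast
    then have "g = [:v:] + Polynomial.smult w P"
      by (simp add: algebra_simps)
    then have "pderiv g = Polynomial.smult w (pderiv P)"
      by (simp add: pderiv_add pderiv_smult pderiv_pCons)
    with t show ?thesis
      by (simp add: g_def)
  qed
  then have ker: "jacobian_at n F (t \<cdot>\<^sub>v b) *\<^sub>v b = 0\<^sub>v m"
    unfolding jacobian_at_mult_vec[OF assms(3,6)] by auto
  have "jacobian_at n F (t \<cdot>\<^sub>v b) \<in> carrier_mat m n"
    using assms(3) by (auto simp: jacobian_at_def jacobian_def poly_map_def)
  then have "vec_space.rank m (jacobian_at n F (t \<cdot>\<^sub>v b)) < n"
    using vec_space.rank_less_if_kernel_nonzero assms(6,7) ker by blast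
  with ker show ?thesis
    by blast
qed

end
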